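(* Let $1\to N\to G\overset{\pi}{\to} Q\to 1$ be a short exact sequence of finitely generated groups, with word-lengths $\ell_N,\ell_G,\ell_Q$ associated to finite generating sets $S_N,S_G,S_Q$ of $N,G,Q$ respectively. The following conditions are equivalent: (1) there exists a section $\sigma\colon Q\to G$ of $\pi$ such that the corresponding functions $\beta\colon Q\times Q\to N$, $\beta(p,q)=\sigma(p)\sigma(q)\sigma(pq)^{-1}$, and $\theta\colon Q\to\operatorname{Aut}(N)$, $\theta(q)(n)=\sigma(q)n\sigma(q)^{-1}$, satisfy, for some constants $A,B,a,b>0$, $$\ell_N(\beta(p,q))\le A(1+\ell_Q(p))^{a}(1+\ell_Q(q))^{a}\quad\text{for all }p,q\in Q,$$ and $$\ell_N(\theta(q)(s))\le B(1+\ell_Q(q))^{b}\quad\text{for all } q\in Q,\ s\in S_N;$$ (2) $N$ has polynomial distortion in $G$.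
   Context: Finitely generated groups are regarded as discrete groups, and $N$ is identified with a normal subgroup of $G$. The word-length associated to a generating set $S$ is $\ell(x)=\min\{n: x\in (S\cup S^{-1})^n\}$. A section of $\pi$ is a map $\sigma\colon Q\to G$ with $\pi\circ\sigma=\mathrm{id}_Q$. The subgroup $N$ is polynomially distorted (has polynomial distortion) in $G$ if there exist constants $C,r>0$ such that $\ell_N(n)\le C(1+\ell_G(n))^r$ for all $n\in N$. *)

theory Defs
  imports Complex_Main "HOL-Algebra.Algebra"
begin

primrec set_pow :: "('a, 'm) monoid_scheme \<Rightarrow> 'a set \<Rightarrow> nat \<Rightarrow> 'a set" where
  "set_pow G T 0 = {\<one>\<^bsub>G\<^esub>}"
| "set_pow G T (Suc n) = set_pow G T n <#>\<^bsub>G\<^esub> T"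

text \<open>The identity is the empty product, so it has length 0. The value is meaningful only for
  elements of the subgroup generated by \<open>S\<close>; see \<open>word_length_exists\<close>.\<close>

definition word_length :: "('a, 'm) monoid_scheme \<Rightarrow> 'a set \<Rightarrow> 'a \<Rightarrow> nat" where
  "word_length G S x = (LEAST n. x \<in> set_pow G (S \<union> set_inv\<^bsub>G\<^esub> S) n)"

definition finite_generating_set :: "('a, 'm) monoid_scheme \<Rightarrow> 'a set \<Rightarrow> bool" where
  "finite_generating_set G S \<longleftrightarrow> finite S \<and> S \<subseteq> carrier G \<and> generate G S = carrier G"

text \<open>The subgroup \<open>N\<close> is a subset of \<open>carrier G\<close>; as a group it is \<open>G\<lparr>carrier := N\<rparr>\<close>, and its
  length refers to products of elements of its own generating set \<open>SN\<close>.\<close>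

definition polynomially_distorted ::
    "('a, 'm) monoid_scheme \<Rightarrow> 'a set \<Rightarrow> 'a set \<Rightarrow> 'a set \<Rightarrow> bool" where
  "polynomially_distorted G SG N SN \<longleftrightarrow>
     (\<exists>C r :: real. C > 0 \<and> r > 0 \<and>
        (\<forall>n\<in>N. real (word_length (G\<lparr>carrier := N\<rparr>) SN n)
                 \<le> C * (1 + real (word_length G SG n)) powr r))"

text \<open>A section is only a map of sets, not a homomorphism.\<close>

definition group_section ::
    "('a, 'm) monoid_scheme \<Rightarrow> ('b, 'k) monoid_scheme \<Rightarrow> ('a \<Rightarrow> 'b) \<Rightarrow> ('b \<Rightarrow> 'a) \<Rightarrow> bool" where
  "group_section G Q \<pi> \<sigma> \<longleftrightarrow> \<sigma> \<in> carrier Q \<rightarrow> carrier G \<and> (\<forall>q\<in>carrier Q. \<pi> (\<sigma> q) = q)"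

definition section_beta ::
    "('a, 'm) monoid_scheme \<Rightarrow> ('b, 'k) monoid_scheme \<Rightarrow> ('b \<Rightarrow> 'a) \<Rightarrow> 'b \<Rightarrow> 'b \<Rightarrow> 'a" where
  "section_beta G Q \<sigma> p q = \<sigma> p \<otimes>\<^bsub>G\<^esub> \<sigma> q \<otimes>\<^bsub>G\<^esub> inv\<^bsub>G\<^esub> (\<sigma> (p \<otimes>\<^bsub>Q\<^esub> q))"

text \<open>Restricted to \<open>N\<close> because \<^const>\<open>auto\<close> consists of extensional functions.\<close>

definition section_theta ::
    "('a, 'm) monoid_scheme \<Rightarrow> 'a set \<Rightarrow> ('b \<Rightarrow> 'a) \<Rightarrow> 'b \<Rightarrow> 'a \<Rightarrow> 'a" where
  "section_theta G N \<sigma> q = (\<lambda>n\<in>N. \<sigma> q \<otimes>\<^bsub>G\<^esub> n \<otimes>\<^bsub>G\<^esub> inv\<^bsub>G\<^esub> (\<sigma> q))"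

lemma set_pow_closed:
  assumes "group G" "T \<subseteq> carrier G"
  shows "set_pow G T n \<subseteq> carrier G"
proof -
  interpret group G by fact
  show ?thesis by (induction n) (use assms in \<open>auto simp: set_mult_closed\<close>)
qed

lemma set_pow_add:
  assumes "group G" "T \<subseteq> carrier G"
  shows "set_pow G T (m + n) = set_pow G T m <#>\<^bsub>G\<^esub> set_pow G T n"
proof -
  interpret group G by fact
  have T: "set_pow G T k \<subseteq> carrier G" for k using set_pow_closed[OF assms] .
  show ?thesis
  proof (induction n)
    case 0
    then show ?case using T[of m] by (force simp: set_mult_def)
  next
    case (Suc n)
    then show ?case using T[of m] T[of n] assms by (simp add: set_mult_assoc)
  qed
qed

lemma word_length_exists:
  assumes "group G" "finite_generating_set G S" "x \<in> carrier G"
  shows "\<exists>n. x \<in> set_pow G (S \<union> set_inv\<^bsub>G\<^esub> S) n"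
proof -
  interpret group G by fact
  let ?T = "S \<union> set_inv\<^bsub>G\<^esub> S"
  have S: "S \<subseteq> carrier G" "x \<in> generate G S"
    using assms by (auto simp: finite_generating_set_def)
  have T: "?T \<subseteq> carrier G" using S by (auto simp: SET_INV_def)
  have one: "y \<in> set_pow G ?T 1" if "y \<in> ?T" for y
  proof -
    have "y = \<one>\<^bsub>G\<^esub> \<otimes>\<^bsub>G\<^esub> y" using that T by auto
    then show ?thesis using that unfolding One_nat_def set_pow.simps set_mult_def by blast
  qed
  show ?thesis using S(2)
  proof (induction rule: generate.induct)
    case one
    have "\<one>\<^bsub>G\<^esub> \<in> set_pow G ?T 0" by simp
    then show ?case by blast
  next
    case (incl h)
    then show ?case using one[of h] by blast
  next
    case (inv h)
    then have "inv\<^bsub>G\<^esub> h \<in> ?T" by (auto simp: SET_INV_def)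
    then show ?case using one by blast
  next
    case (eng h1 h2)
    then obtain m n where "h1 \<in> set_pow G ?T m" "h2 \<in> set_pow G ?T n" by blast
    then have "h1 \<otimes>\<^bsub>G\<^esub> h2 \<in> set_pow G ?T (m + n)"
      unfolding set_pow_add[OF \<open>group G\<close> T] by (auto simp: set_mult_def)
    then show ?case by blast
  qed
qed

lemma section_beta_closed:
  assumes "group G" "group Q" "\<pi> \<in> hom G Q" "kernel G Q \<pi> = N" "group_section G Q \<pi> \<sigma>"
    and "p \<in> carrier Q" "q \<in> carrier Q"
  shows "section_beta G Q \<sigma> p q \<in> N"
proof -
  interpret group_hom G Q \<pi>
    using assms by (simp add: group_hom_def group_hom_axioms_def)
  have [simp]: "\<sigma> u \<in> carrier G" "\<pi> (\<sigma> u) = u" if "u \<in> carrier Q" for u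
    using assms(5) that by (auto simp: group_section_def)
  show ?thesis
    using assms(6,7) by (auto simp: section_beta_def kernel_def simp flip: assms(4))
qed

lemma section_theta_auto:
  assumes "N \<lhd> G" "group_section G Q \<pi> \<sigma>" "q \<in> carrier Q"
  shows "section_theta G N \<sigma> q \<in> auto (G\<lparr>carrier := N\<rparr>)"
proof -
  interpret normal N G by fact
  let ?g = "\<sigma> q"
  have g: "?g \<in> carrier G" using assms by (auto simp: group_section_def)
  have sub: "n \<in> carrier G" if "n \<in> N" for n using that subset by blast
  have cl: "?g \<otimes>\<^bsub>G\<^esub> n \<otimes>\<^bsub>G\<^esub> inv\<^bsub>G\<^esub> ?g \<in> N" if "n \<in> N" for n
    using inv_op_closed2[OF g that] .
  have cl': "inv\<^bsub>G\<^esub> ?g \<otimes>\<^bsub>G\<^esub> n \<otimes>\<^bsub>G\<^esub> ?g \<in> N" if "n \<in> N" for n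
    using inv_op_closed1[OF g that] .
  have can: "inv\<^bsub>G\<^esub> ?g \<otimes>\<^bsub>G\<^esub> (?g \<otimes>\<^bsub>G\<^esub> z) = z" "?g \<otimes>\<^bsub>G\<^esub> (inv\<^bsub>G\<^esub> ?g \<otimes>\<^bsub>G\<^esub> z) = z"
    if "z \<in> carrier G" for z
    using g that by (simp_all flip: m_assoc)
  have m: "?g \<otimes>\<^bsub>G\<^esub> (x \<otimes>\<^bsub>G\<^esub> y) \<otimes>\<^bsub>G\<^esub> inv\<^bsub>G\<^esub> ?g
      = (?g \<otimes>\<^bsub>G\<^esub> x \<otimes>\<^bsub>G\<^esub> inv\<^bsub>G\<^esub> ?g) \<otimes>\<^bsub>G\<^esub> (?g \<otimes>\<^bsub>G\<^esub> y \<otimes>\<^bsub>G\<^esub> inv\<^bsub>G\<^esub> ?g)"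
    if "x \<in> N" "y \<in> N" for x y
    using g sub[OF that(1)] sub[OF that(2)] by (simp add: m_assoc can)
  have "bij_betw (section_theta G N \<sigma> q) N N"
    by (rule bij_betw_byWitness[where f' = "\<lambda>n. inv\<^bsub>G\<^esub> ?g \<otimes>\<^bsub>G\<^esub> n \<otimes>\<^bsub>G\<^esub> ?g"])
      (use g sub cl cl' in \<open>auto simp: section_theta_def m_assoc can\<close>)
  then show ?thesis
    using cl m by (auto simp: auto_def Bij_def hom_def section_theta_def)
qed

end

theory Submission
  imports Defs
begin

text \<open>
  Write \<open>|x|\<close> for the word length in the group in question.

  If \<open>N\<close> is polynomially distorted, lift each \<open>q\<close> to \<open>G\<close> letter by letter along a shortest word.
  This gives a section with \<open>|\<sigma> q| \<le> M |q|\<close> (lemma \<open>exists_short_section\<close>). Then \<open>\<beta>(p,q)\<close> and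
  \<open>\<theta>(q)(s)\<close> have length in \<open>G\<close> bounded linearly in \<open>|p|\<close> and \<open>|q|\<close>, and distortion turns
  this into a polynomial bound in \<open>N\<close>.

  Conversely, given a section \<open>\<sigma>\<close>, every \<open>x\<close> in \<open>G\<close> factors as \<open>x = \<nu>(x) \<sigma>(\<pi> x)\<close> with
  \<open>\<nu>(x) \<in> N\<close>. The key is the cocycle identity (lemma \<open>normal_part_mult\<close>)
  \<open>\<nu>(x t) = \<nu>(x) \<theta>(\<pi> x)(\<nu>(t)) \<beta>(\<pi> x, \<pi> t)\<close>.
  For a letter \<open>t\<close>, the last two factors have length polynomial in \<open>|x|\<close>: the automorphism
  \<open>\<theta>(q)\<close> multiplies lengths at most by the maximal length of its values on \<open>SN\<close>, and \<open>\<nu>(t)\<close> takes only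
  finitely many values. Summing along a shortest word for \<open>x\<close> bounds \<open>|\<nu>(x)|\<close> polynomially, with
  the exponent increased by one. If \<open>x \<in> N\<close>, then \<open>x\<close> and \<open>\<nu>(x)\<close> differ by the constant \<open>\<sigma>(1)\<close>.
\<close>

section \<open>Word length in a finitely generated group\<close>

text \<open>A group with a chosen finite generating set.\<close>

locale fg_group = group G for G (structure) +
  fixes S
  assumes finite_generating: "finite_generating_set G S"
begin

abbreviation letters where "letters \<equiv> S \<union> set_inv S"

abbreviation len where "len \<equiv> word_length G S"

lemma gens_closed: "S \<subseteq> carrier G"
  using finite_generating by (simp add: finite_generating_set_def)

lemma letters_closed: "letters \<subseteq> carrier G"
  using gens_closed by (auto simp: SET_INV_def)

lemma finite_letters: "finite letters"
  using finite_generating by (simp add: finite_generating_set_def SET_INV_def)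

lemma mem_set_pow_len: "x \<in> carrier G \<Longrightarrow> x \<in> set_pow G letters (len x)"
  unfolding word_length_def
  using word_length_exists[OF is_group finite_generating] by (rule LeastI_ex)

lemma len_le: "x \<in> set_pow G letters n \<Longrightarrow> len x \<le> n"
  unfolding word_length_def by (rule Least_le)

lemma len_one [simp]: "len \<one> = 0"
  using len_le[of \<one> 0] by simp

lemma len_letter:
  assumes "t \<in> letters"
  shows "len t \<le> 1"
proof -
  have "t = \<one> \<otimes> t" using assms letters_closed by auto
  then have "t \<in> set_pow G letters 1"
    using assms unfolding One_nat_def set_pow.simps set_mult_def by blast
  then show ?thesis by (rule len_le)
qed

lemma len_mult:
  assumes "x \<in> carrier G" "y \<in> carrier G"
  shows "len (x \<otimes> y) \<le> len x + len y"
proof (rule len_le)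
  show "x \<otimes> y \<in> set_pow G letters (len x + len y)"
    unfolding set_pow_add[OF is_group letters_closed]
    using mem_set_pow_len[OF assms(1)] mem_set_pow_len[OF assms(2)]
    by (auto simp: set_mult_def)
qed

lemma len_mult3:
  assumes "x \<in> carrier G" "y \<in> carrier G" "z \<in> carrier G"
  shows "len (x \<otimes> y \<otimes> z) \<le> len x + len y + len z"
  using len_mult[of "x \<otimes> y" z] len_mult[of x y] assms by simp

text \<open>Induction along a geodesic word.\<close>

lemma len_induct [consumes 1, case_names one step]:
  assumes "x \<in> carrier G"
    and one: "P \<one>"
    and step: "\<And>y t. \<lbrakk>y \<in> carrier G; t \<in> letters; len (y \<otimes> t) = Suc (len y); P y\<rbrakk>
      \<Longrightarrow> P (y \<otimes> t)"
  shows "P x"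
  using assms(1)
proof (induction "len x" arbitrary: x)
  case 0
  then have "x \<in> set_pow G letters 0" using mem_set_pow_len[of x] by simp
  then show ?case using one by simp
next
  case (Suc n)
  have "x \<in> set_pow G letters (Suc n)"
    using mem_set_pow_len[OF Suc.prems] Suc.hyps(2) by simp
  then obtain y t where yt: "y \<in> set_pow G letters n" "t \<in> letters" "x = y \<otimes> t"
    by (auto simp: set_mult_def)
  have y: "y \<in> carrier G" using set_pow_closed[OF is_group letters_closed] yt(1) by blast
  have t: "t \<in> carrier G" using letters_closed yt(2) by blast
  have "len y = n"
    using len_le[OF yt(1)] len_mult[OF y t] len_letter[OF yt(2)] Suc.hyps(2) yt(3) by simp
  then show ?case using Suc.hyps step[OF y yt(2)] y yt(3) by simp
qed

lemma inv_letter: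
  assumes "t \<in> letters"
  shows "inv t \<in> letters"
  using assms gens_closed by (auto simp: SET_INV_def)

lemma len_inv_le:
  assumes "x \<in> carrier G"
  shows "len (inv x) \<le> len x"
  using assms
proof (induction rule: len_induct)
  case one
  then show ?case by simp
next
  case (step y t)
  have t: "t \<in> carrier G" using step letters_closed by blast
  have "len (inv (y \<otimes> t)) \<le> len (inv t) + len (inv y)"
    using step(1) t len_mult[of "inv t" "inv y"] by (simp add: inv_mult_group)
  also have "\<dots> \<le> Suc (len y)"
    using len_letter[OF inv_letter[OF step(2)]] step(4) by simp
  finally show ?case using step(3) by simp
qed

end

lemma finite_bounded_obtain:
  fixes f :: "'a \<Rightarrow> nat"
  assumes "finite A"
  obtains K where "\<And>x. x \<in> A \<Longrightarrow> f x \<le> K"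
  using assms by (metis Max_ge finite_imageI imageI)

text \<open>A homomorphism is Lipschitz, with constant any bound for its values on the generators. The
  constant is explicit because, for the automorphisms \<open>\<theta>(q)\<close>, it depends on \<open>q\<close>.\<close>

lemma hom_len_le:
  fixes K :: real
  assumes "fg_group G S" "fg_group H T" and h: "h \<in> hom G H"
    and K: "\<And>s. s \<in> S \<Longrightarrow> real (word_length H T (h s)) \<le> K"
    and x: "x \<in> carrier G"
  shows "real (word_length H T (h x)) \<le> K * real (word_length G S x)"
proof -
  interpret G: fg_group G S by fact
  interpret H: fg_group H T by fact
  interpret group_hom G H h using h by unfold_locales
  have letter: "real (H.len (h t)) \<le> K" if "t \<in> G.letters" for t
    using that
  proof
    assume "t \<in> S"
    then show ?thesis by (rule K)
  next
    assume "t \<in> set_inv\<^bsub>G\<^esub> S"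
    then obtain s where s: "s \<in> S" "t = inv\<^bsub>G\<^esub> s" by (auto simp: SET_INV_def)
    have "s \<in> carrier G" using s G.gens_closed by blast
    then have "H.len (h t) \<le> H.len (h s)" using s H.len_inv_le[of "h s"] by simp
    then show ?thesis using K[OF s(1)] by simp
  qed
  show ?thesis using x
  proof (induction rule: G.len_induct)
    case one
    then show ?case by simp
  next
    case (step y t)
    have t: "t \<in> carrier G" using step G.letters_closed by blast
    have "real (H.len (h (y \<otimes>\<^bsub>G\<^esub> t))) \<le> real (H.len (h y)) + real (H.len (h t))"
      using H.len_mult[of "h y" "h t"] step(1) t by (simp flip: of_nat_add)
    also have "\<dots> \<le> K * real (G.len y) + K" using step(4) letter[OF step(2)] by simp
    finally show ?case using step(3) by (simp add: algebra_simps)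
  qed
qed

section \<open>Extensions of finitely generated groups\<close>

text \<open>The extension \<open>1 \<rightarrow> N \<rightarrow> G \<rightarrow> Q \<rightarrow> 1\<close> with all three groups finitely generated; \<open>N\<close> is a subset
  of \<open>carrier G\<close>, so its group structure is \<open>G\<lparr>carrier := N\<rparr>\<close>.\<close>

locale fg_extension =
  normal N G + G: fg_group G SG + Q: fg_group Q SQ + N: fg_group "G\<lparr>carrier := N\<rparr>" SN
  for G :: "('a, 'm) monoid_scheme" (structure) and N SG
    and Q :: "('b, 'k) monoid_scheme" and SQ SN +
  fixes \<pi> :: "'a \<Rightarrow> 'b"
  assumes epi: "\<pi> \<in> epi G Q" and ker: "kernel G Q \<pi> = N"
begin

sublocale hom: group_hom G Q \<pi>
  using epi by unfold_locales (simp add: epi_def)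

lemma N_carrier: "n \<in> N \<Longrightarrow> n \<in> carrier G"
  using subset by blast

lemma N_iff: "n \<in> N \<longleftrightarrow> n \<in> carrier G \<and> \<pi> n = \<one>\<^bsub>Q\<^esub>"
  using ker by (auto simp: kernel_def)

lemma lenN_mult: "x \<in> N \<Longrightarrow> y \<in> N \<Longrightarrow> N.len (x \<otimes> y) \<le> N.len x + N.len y"
  using N.len_mult by simp

lemma lenN_mult3:
  "x \<in> N \<Longrightarrow> y \<in> N \<Longrightarrow> z \<in> N \<Longrightarrow> N.len (x \<otimes> y \<otimes> z) \<le> N.len x + N.len y + N.len z"
  using N.len_mult3 by simp

lemma exists_short_section:
  obtains \<sigma> M where "group_section G Q \<pi> \<sigma>"
    and "\<And>q. q \<in> carrier Q \<Longrightarrow> G.len (\<sigma> q) \<le> M * Q.len q"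
proof -
  have lift: "\<exists>x. x \<in> carrier G \<and> \<pi> x = q" if "q \<in> carrier Q" for q
  proof -
    have "\<pi> ` carrier G = carrier Q" using epi by (simp add: epi_def)
    then have "q \<in> \<pi> ` carrier G" using that by simp
    then show ?thesis by (elim imageE) (intro exI conjI, assumption, rule sym)
  qed
  then obtain l where l: "\<And>q. q \<in> carrier Q \<Longrightarrow> l q \<in> carrier G \<and> \<pi> (l q) = q"
    using bchoice[of "carrier Q" "\<lambda>q x. x \<in> carrier G \<and> \<pi> x = q"] by blast
  obtain M where M: "\<And>t. t \<in> Q.letters \<Longrightarrow> G.len (l t) \<le> M"
    using finite_bounded_obtain[OF Q.finite_letters, of "\<lambda>t. G.len (l t)"] by blast
  have "\<exists>x. x \<in> carrier G \<and> \<pi> x = q \<and> G.len x \<le> M * Q.len q" if "q \<in> carrier Q" for q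
    using that
  proof (induction rule: Q.len_induct)
    case one
    then show ?case by (intro exI[of _ \<one>]) simp
  next
    case (step p t)
    then obtain x where x: "x \<in> carrier G" "\<pi> x = p" "G.len x \<le> M * Q.len p" by blast
    have t: "l t \<in> carrier G" "\<pi> (l t) = t" using l step(2) Q.letters_closed by blast+
    have "G.len (x \<otimes> l t) \<le> M * Q.len p + M"
      using G.len_mult[OF x(1) t(1)] x(3) M[OF step(2)] by simp
    then show ?case using x t step(3) by (intro exI[of _ "x \<otimes> l t"]) simp
  qed
  then obtain \<sigma> where "\<And>q. q \<in> carrier Q \<Longrightarrow>
      \<sigma> q \<in> carrier G \<and> \<pi> (\<sigma> q) = q \<and> G.len (\<sigma> q) \<le> M * Q.len q"
    by metis
  then show thesis using that[of \<sigma> M] by (auto simp: group_section_def)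
qed

text \<open>The control on a section required in the theorem: its cocycle and its action on the
  generators of \<open>N\<close> are polynomially bounded.\<close>

definition polynomial_section where
  "polynomial_section \<sigma> \<longleftrightarrow> group_section G Q \<pi> \<sigma> \<and>
     (\<exists>A B a b :: real. A > 0 \<and> B > 0 \<and> a > 0 \<and> b > 0 \<and>
       (\<forall>p\<in>carrier Q. \<forall>q\<in>carrier Q. real (N.len (section_beta G Q \<sigma> p q))
          \<le> A * (1 + real (Q.len p)) powr a * (1 + real (Q.len q)) powr a) \<and>
       (\<forall>q\<in>carrier Q. \<forall>s\<in>SN. real (N.len (section_theta G N \<sigma> q s))
          \<le> B * (1 + real (Q.len q)) powr b))"

section \<open>Distortion yields a polynomially bounded section\<close>

lemma distorted_imp_polynomial_section:
  assumes "polynomially_distorted G SG N SN"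
  shows "\<exists>\<sigma>. polynomial_section \<sigma>"
proof -
  obtain C r :: real where C: "C > 0" "r > 0"
    and dist: "\<And>n. n \<in> N \<Longrightarrow> real (N.len n) \<le> C * (1 + real (G.len n)) powr r"
    using assms by (auto simp: polynomially_distorted_def)
  obtain \<sigma> M where sec: "group_section G Q \<pi> \<sigma>"
    and M: "\<And>q. q \<in> carrier Q \<Longrightarrow> G.len (\<sigma> q) \<le> M * Q.len q"
    using exists_short_section by blast
  have \<sigma>: "\<sigma> q \<in> carrier G" if "q \<in> carrier Q" for q
    using sec that by (auto simp: group_section_def)
  have SN: "finite SN" "SN \<subseteq> N"
    using N.finite_generating by (auto simp: finite_generating_set_def)
  obtain K where K: "\<And>s. s \<in> SN \<Longrightarrow> G.len s \<le> K"
    using finite_bounded_obtain[OF SN(1), of G.len] by blast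
  \<comment> \<open>One constant for both bounds: \<open>|\<beta>(p,q)| \<le> 2 M (|p| + |q|)\<close> and
    \<open>|\<theta>(q)(s)| \<le> 2 M |q| + K\<close> in \<open>G\<close>.\<close>
  define c where "c = real (1 + 2 * M + K)"
  have c: "c > 0" by (simp add: c_def)
  have transfer: "real (N.len n) \<le> C * c powr r * y powr r"
    if "n \<in> N" "1 + real (G.len n) \<le> c * y" "y > 0" for n y
  proof -
    have "(1 + real (G.len n)) powr r \<le> (c * y) powr r"
      using that C by (intro powr_mono2) auto
    also have "\<dots> = c powr r * y powr r" using c that(3) by (simp add: powr_mult)
    finally show ?thesis using dist[OF that(1)] C(1)
      by (smt (verit, best) mult.assoc mult_left_mono)
  qed
  have beta: "real (N.len (section_beta G Q \<sigma> p q))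
      \<le> C * c powr r * (1 + real (Q.len p)) powr r * (1 + real (Q.len q)) powr r"
    if pq: "p \<in> carrier Q" "q \<in> carrier Q" for p q
  proof -
    have b: "section_beta G Q \<sigma> p q \<in> N"
      by (rule section_beta_closed[OF is_group Q.is_group hom.homh ker sec pq])
    have "G.len (section_beta G Q \<sigma> p q)
        \<le> G.len (\<sigma> p) + G.len (\<sigma> q) + G.len (\<sigma> (p \<otimes>\<^bsub>Q\<^esub> q))"
      unfolding section_beta_def
      using G.len_mult3[of "\<sigma> p" "\<sigma> q" "inv \<sigma> (p \<otimes>\<^bsub>Q\<^esub> q)"]
        G.len_inv_le[of "\<sigma> (p \<otimes>\<^bsub>Q\<^esub> q)"] \<sigma> pq by simp
    also have "\<dots> \<le> M * Q.len p + M * Q.len q + M * (Q.len p + Q.len q)"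
      using M pq Q.len_mult[OF pq] mult_le_mono2[OF Q.len_mult[OF pq], of M]
      by (intro add_mono order.trans[OF M]) auto
    finally have "1 + G.len (section_beta G Q \<sigma> p q)
        \<le> (1 + 2 * M + K) * ((1 + Q.len p) * (1 + Q.len q))"
      by (simp add: algebra_simps)
    then have "1 + real (G.len (section_beta G Q \<sigma> p q))
        \<le> c * ((1 + real (Q.len p)) * (1 + real (Q.len q)))"
      unfolding c_def by (simp flip: of_nat_Suc of_nat_add of_nat_mult)
    from transfer[OF b this] show ?thesis by (simp add: powr_mult)
  qed
  have theta: "real (N.len (section_theta G N \<sigma> q s)) \<le> C * c powr r * (1 + real (Q.len q)) powr r"
    if q: "q \<in> carrier Q" and s: "s \<in> SN" for q s
  proof -
    have sN: "s \<in> N" using s SN by blast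
    have t: "section_theta G N \<sigma> q s = \<sigma> q \<otimes> s \<otimes> inv \<sigma> q"
      using sN by (simp add: section_theta_def)
    have b: "section_theta G N \<sigma> q s \<in> N"
      unfolding t using inv_op_closed2[OF \<sigma>[OF q] sN] .
    have "G.len (section_theta G N \<sigma> q s) \<le> 2 * (M * Q.len q) + K"
      unfolding t using G.len_mult3[of "\<sigma> q" s "inv \<sigma> q"] G.len_inv_le[of "\<sigma> q"]
        \<sigma>[OF q] N_carrier[OF sN] K[OF s] M[OF q] by simp
    then have "1 + G.len (section_theta G N \<sigma> q s) \<le> (1 + 2 * M + K) * (1 + Q.len q)"
      by (simp add: algebra_simps)
    then have "1 + real (G.len (section_theta G N \<sigma> q s)) \<le> c * (1 + real (Q.len q))"
      unfolding c_def by (simp flip: of_nat_Suc of_nat_add of_nat_mult)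
    from transfer[OF b this] show ?thesis by simp
  qed
  have "C * c powr r > 0" using C c by simp
  then show ?thesis unfolding polynomial_section_def using sec C(2) beta theta by blast
qed

section \<open>A polynomially bounded section yields distortion\<close>

text \<open>The \<open>N\<close>-component \<open>\<nu>(x)\<close> in the factorisation \<open>x = \<nu>(x) \<sigma>(\<pi> x)\<close>.\<close>

definition normal_part where
  "normal_part \<sigma> x = x \<otimes> inv \<sigma> (\<pi> x)"

lemma normal_part_closed:
  assumes "group_section G Q \<pi> \<sigma>" "x \<in> carrier G"
  shows "normal_part \<sigma> x \<in> N"
proof -
  have "\<sigma> (\<pi> x) \<in> carrier G" "\<pi> (\<sigma> (\<pi> x)) = \<pi> x"
    using assms by (auto simp: group_section_def)
  then show ?thesis using assms(2) by (simp add: N_iff normal_part_def)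
qed

lemma normal_part_mult:
  assumes sec: "group_section G Q \<pi> \<sigma>" and x: "x \<in> carrier G" and t: "t \<in> carrier G"
  shows "normal_part \<sigma> (x \<otimes> t)
    = normal_part \<sigma> x \<otimes> section_theta G N \<sigma> (\<pi> x) (normal_part \<sigma> t)
        \<otimes> section_beta G Q \<sigma> (\<pi> x) (\<pi> t)"
proof -
  have \<sigma>: "\<sigma> q \<in> carrier G" if "q \<in> carrier Q" for q
    using sec that by (auto simp: group_section_def)
  note c = \<sigma>[OF hom.hom_closed[OF x]] \<sigma>[OF hom.hom_closed[OF t]]
    \<sigma>[OF hom.hom_closed[OF m_closed[OF x t]]]
  have cancel: "inv a \<otimes> (a \<otimes> z) = z" if "a \<in> carrier G" "z \<in> carrier G" for a z
    using that by (simp flip: m_assoc)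
  show ?thesis
    using x t c normal_part_closed[OF sec t]
    by (simp add: section_theta_def section_beta_def normal_part_def m_assoc cancel)
qed

lemma section_theta_hom:
  assumes "group_section G Q \<pi> \<sigma>" "q \<in> carrier Q"
  shows "section_theta G N \<sigma> q \<in> hom (G\<lparr>carrier := N\<rparr>) (G\<lparr>carrier := N\<rparr>)"
  using section_theta_auto[OF normal_axioms assms] by (simp add: auto_def)

lemma polynomial_section_imp_distorted:
  assumes "polynomial_section \<sigma>"
  shows "polynomially_distorted G SG N SN"
proof -
  obtain A B a b :: real where pos: "A > 0" "B > 0" "a > 0" "b > 0"
    and sec: "group_section G Q \<pi> \<sigma>"
    and beta: "\<And>p q. p \<in> carrier Q \<Longrightarrow> q \<in> carrier Q \<Longrightarrow>
      real (N.len (section_beta G Q \<sigma> p q))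
        \<le> A * (1 + real (Q.len p)) powr a * (1 + real (Q.len q)) powr a"
    and theta: "\<And>q s. q \<in> carrier Q \<Longrightarrow> s \<in> SN \<Longrightarrow>
      real (N.len (section_theta G N \<sigma> q s)) \<le> B * (1 + real (Q.len q)) powr b"
    using assms unfolding polynomial_section_def by blast
  obtain L where L: "\<And>t. t \<in> G.letters \<Longrightarrow> Q.len (\<pi> t) \<le> L"
    using finite_bounded_obtain[OF G.finite_letters, of "\<lambda>t. Q.len (\<pi> t)"] by blast
  obtain K where K: "\<And>t. t \<in> G.letters \<Longrightarrow> N.len (normal_part \<sigma> t) \<le> K"
    using finite_bounded_obtain[OF G.finite_letters, of "\<lambda>t. N.len (normal_part \<sigma> t)"] by blast
  \<comment> \<open>Appending a letter to \<open>x\<close> increases \<open>|\<nu>(x)|\<close> by at most \<open>D (1 + |x|)\<^sup>e\<close>: the summands of \<open>D\<close>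
    come from \<open>\<theta>\<close> and \<open>\<beta>\<close>.\<close>
  define l where "l = 1 + real L"
  define e where "e = max a b"
  define D where "D = B * l powr b * real K + A * l powr a * l powr a"
  have l: "l \<ge> 1" by (simp add: l_def)
  have e: "e > 0" using pos by (simp add: e_def)
  have D: "D \<ge> 0" using pos by (simp add: D_def)
  have len_\<pi>: "1 + real (Q.len (\<pi> x)) \<le> l * (1 + real (G.len x))" if "x \<in> carrier G" for x
  proof -
    have "real (Q.len (\<pi> x)) \<le> real L * real (G.len x)"
      by (rule hom_len_le[OF G.fg_group_axioms Q.fg_group_axioms hom.homh _ that]) (use L in auto)
    then show ?thesis by (simp add: l_def algebra_simps)
  qed
  have powr_\<pi>: "(1 + real (Q.len (\<pi> x))) powr u \<le> l powr u * (1 + real (G.len x)) powr e"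
    if "x \<in> carrier G" "0 < u" "u \<le> e" for x u
  proof -
    have "(1 + real (Q.len (\<pi> x))) powr u \<le> (l * (1 + real (G.len x))) powr u"
      using len_\<pi>[OF that(1)] that(2) by (intro powr_mono2) auto
    also have "\<dots> = l powr u * (1 + real (G.len x)) powr u"
      using l by (simp add: powr_mult)
    also have "\<dots> \<le> l powr u * (1 + real (G.len x)) powr e"
      using that(3) by (intro mult_left_mono powr_mono) auto
    finally show ?thesis .
  qed
  have increment: "real (N.len (normal_part \<sigma> (x \<otimes> t)))
      \<le> real (N.len (normal_part \<sigma> x)) + D * (1 + real (G.len x)) powr e"
    if x: "x \<in> carrier G" and t: "t \<in> G.letters" for x t
  proof -
    let ?\<nu> = "normal_part \<sigma>"
    let ?\<theta> = "section_theta G N \<sigma> (\<pi> x) (?\<nu> t)" and ?\<beta> = "section_beta G Q \<sigma> (\<pi> x) (\<pi> t)"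
    let ?E = "(1 + real (G.len x)) powr e"
    have tc: "t \<in> carrier G" using t G.letters_closed by blast
    have \<nu>: "?\<nu> x \<in> N" "?\<nu> t \<in> N" using normal_part_closed[OF sec] x tc by auto
    have \<theta>N: "?\<theta> \<in> N"
      using section_theta_hom[OF sec, of "\<pi> x"] \<nu>(2) x by (auto simp: hom_def)
    have \<beta>N: "?\<beta> \<in> N"
      using section_beta_closed[OF is_group Q.is_group hom.homh ker sec, of "\<pi> x" "\<pi> t"] x tc
      by simp
    have "real (N.len ?\<theta>) \<le> B * (1 + real (Q.len (\<pi> x))) powr b * real (N.len (?\<nu> t))"
      by (rule hom_len_le[OF N.fg_group_axioms N.fg_group_axioms section_theta_hom[OF sec]])
        (use x \<nu> theta in auto)
    also have "\<dots> \<le> B * (l powr b * ?E) * real K"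
      using powr_\<pi>[OF x pos(4)] K[OF t] pos by (intro mult_mono) (auto simp: e_def)
    finally have \<theta>: "real (N.len ?\<theta>) \<le> B * l powr b * real K * ?E"
      by (simp add: mult_ac)
    have "real (N.len ?\<beta>)
        \<le> A * (1 + real (Q.len (\<pi> x))) powr a * (1 + real (Q.len (\<pi> t))) powr a"
      using beta[of "\<pi> x" "\<pi> t"] x tc by simp
    also have "\<dots> \<le> A * (l powr a * ?E) * l powr a"
      using powr_\<pi>[OF x pos(3)] L[OF t] pos
      by (intro mult_mono powr_mono2) (auto simp: e_def l_def)
    finally have \<beta>: "real (N.len ?\<beta>) \<le> A * l powr a * l powr a * ?E"
      by (simp add: mult_ac)
    have "N.len (?\<nu> (x \<otimes> t)) \<le> N.len (?\<nu> x) + N.len ?\<theta> + N.len ?\<beta>"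
      unfolding normal_part_mult[OF sec x tc] by (rule lenN_mult3[OF \<nu>(1) \<theta>N \<beta>N])
    then have "real (N.len (?\<nu> (x \<otimes> t)))
        \<le> real (N.len (?\<nu> x)) + real (N.len ?\<theta>) + real (N.len ?\<beta>)"
      by (simp flip: of_nat_add)
    then show ?thesis using \<theta> \<beta> by (simp add: D_def distrib_right)
  qed
  define c where "c = real (N.len (normal_part \<sigma> \<one>))"
  have normal_part_len: "real (N.len (normal_part \<sigma> x))
      \<le> c + real (G.len x) * (D * (1 + real (G.len x)) powr e)" if "x \<in> carrier G" for x
    using that
  proof (induction rule: G.len_induct)
    case one
    then show ?case by (simp add: c_def)
  next
    case (step y t)
    let ?n = "real (G.len y)"
    have "real (N.len (normal_part \<sigma> (y \<otimes> t))) \<le> c + (?n + 1) * (D * (1 + ?n) powr e)"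
      using increment[OF step(1,2)] step(4) by (simp add: distrib_right)
    also have "\<dots> \<le> c + (?n + 1) * (D * (1 + (?n + 1)) powr e)"
      using D e by (intro add_left_mono mult_left_mono powr_mono2) auto
    finally show ?case using step(3) by (simp add: add_ac)
  qed
  have one: "\<sigma> \<one>\<^bsub>Q\<^esub> \<in> N" using sec by (auto simp: N_iff group_section_def)
  define C where "C = c + D + real (N.len (\<sigma> \<one>\<^bsub>Q\<^esub>)) + 1"
  have "real (N.len n) \<le> C * (1 + real (G.len n)) powr (e + 1)" if n: "n \<in> N" for n
  proof -
    let ?m = "1 + real (G.len n)"
    have nc: "n \<in> carrier G" and \<pi>: "\<pi> n = \<one>\<^bsub>Q\<^esub>" using n by (simp_all add: N_iff)
    have "n = normal_part \<sigma> n \<otimes> \<sigma> \<one>\<^bsub>Q\<^esub>"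
      using nc N_carrier[OF one] by (simp add: normal_part_def \<pi> m_assoc)
    then have "N.len n \<le> N.len (normal_part \<sigma> n) + N.len (\<sigma> \<one>\<^bsub>Q\<^esub>)"
      using lenN_mult[OF normal_part_closed[OF sec nc] one] by simp
    then have "real (N.len n) \<le> real (N.len (normal_part \<sigma> n)) + real (N.len (\<sigma> \<one>\<^bsub>Q\<^esub>))"
      by (simp flip: of_nat_add)
    also have "\<dots> \<le> (c + real (N.len (\<sigma> \<one>\<^bsub>Q\<^esub>))) + real (G.len n) * (D * ?m powr e)"
      using normal_part_len[OF nc] by simp
    also have "\<dots> \<le> (c + real (N.len (\<sigma> \<one>\<^bsub>Q\<^esub>)) + 1) * ?m powr (e + 1) + D * ?m powr (e + 1)"
    proof (rule add_mono)
      have "1 \<le> ?m powr (e + 1)" using e by (intro ge_one_powr_ge_zero) auto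
      then show "c + real (N.len (\<sigma> \<one>\<^bsub>Q\<^esub>))
          \<le> (c + real (N.len (\<sigma> \<one>\<^bsub>Q\<^esub>)) + 1) * ?m powr (e + 1)"
        using mult_mono[of "c + real (N.len (\<sigma> \<one>\<^bsub>Q\<^esub>))"
            "c + real (N.len (\<sigma> \<one>\<^bsub>Q\<^esub>)) + 1" 1 "?m powr (e + 1)"]
        by (simp add: c_def)
      have "real (G.len n) * (D * ?m powr e) \<le> ?m * (D * ?m powr e)"
        using D by (intro mult_right_mono) auto
      then show "real (G.len n) * (D * ?m powr e) \<le> D * ?m powr (e + 1)"
        by (simp add: powr_add mult_ac)
    qed
    finally show ?thesis by (simp add: C_def algebra_simps)
  qed
  moreover have "C > 0" using D by (simp add: C_def c_def add_nonneg_pos)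
  moreover have "e + 1 > 0" using e by simp
  ultimately show ?thesis unfolding polynomially_distorted_def by blast
qed

end

section \<open>The equivalence\<close>

theorem proposition5p1:
  fixes G :: "('a, 'm) monoid_scheme" and Q :: "('b, 'k) monoid_scheme"
    and N SN SG :: "'a set" and SQ :: "'b set" and \<pi> :: "'a \<Rightarrow> 'b"
  assumes "group G" and "group Q"
    and "\<pi> \<in> epi G Q" and "N \<lhd> G" and "kernel G Q \<pi> = N"
    and "finite_generating_set (G\<lparr>carrier := N\<rparr>) SN"
    and "finite_generating_set G SG"
    and "finite_generating_set Q SQ"
  shows
    "(\<exists>\<sigma>. group_section G Q \<pi> \<sigma> \<and>
        (\<exists>A B a b :: real. A > 0 \<and> B > 0 \<and> a > 0 \<and> b > 0 \<and>
          (\<forall>p\<in>carrier Q. \<forall>q\<in>carrier Q.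
             real (word_length (G\<lparr>carrier := N\<rparr>) SN (section_beta G Q \<sigma> p q))
               \<le> A * (1 + real (word_length Q SQ p)) powr a
                   * (1 + real (word_length Q SQ q)) powr a) \<and>
          (\<forall>q\<in>carrier Q. \<forall>s\<in>SN.
             real (word_length (G\<lparr>carrier := N\<rparr>) SN (section_theta G N \<sigma> q s))
               \<le> B * (1 + real (word_length Q SQ q)) powr b)))
     \<longleftrightarrow> polynomially_distorted G SG N SN"
proof -
  interpret normal N G by fact
  have "group (G\<lparr>carrier := N\<rparr>)" by (rule subgroup_is_group) fact
  then interpret fg_extension G N SG Q SQ SN \<pi>
    using assms
    by (simp add: fg_extension_def fg_extension_axioms_def fg_group_def fg_group_axioms_def)
  show ?thesis
    using distorted_imp_polynomial_section polynomial_section_imp_distorted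
    unfolding polynomial_section_def by blast
qed

end
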